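(* Let $d,n\geq1$ be integers and let $\boldsymbol{\eta}:(\mathbb{R}^d)^n\to\mathbb{R}^m$ be anti-symmetric and continuously differentiable. For any $\mathbf{x}\in\mathbf{Sing}_{d,n}$, the Jacobian matrix $J\boldsymbol{\eta}(\mathbf{x})\in\mathbb{R}^{m\times nd}$ is column-rank-deficient (i.e. its columns are linearly dependent).
   Context: $\mathbf{Sing}_{d,n}:=\{\mathbf{x}=(\mathbf{x}_1,\dots,\mathbf{x}_n)\in(\mathbb{R}^d)^n : \exists\, i_1\neq i_2,\ \mathbf{x}_{i_1}=\mathbf{x}_{i_2}\}$. A map $\boldsymbol{\eta}:(\mathbb{R}^d)^n\to\mathbb{R}^m$ is anti-symmetric if $\boldsymbol{\eta}(\mathbf{x}_{\sigma(1)},\dots,\mathbf{x}_{\sigma(n)})=(-1)^\sigma\boldsymbol{\eta}(\mathbf{x}_1,\dots,\mathbf{x}_n)$ for all permutations $\sigma\in S_n$ of $\{1,\dots,n\}$ and all $\mathbf{x}_1,\dots,\mathbf{x}_n\in\mathbb{R}^d$, where $(-1)^\sigma$ is the signature of $\sigma$. *)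

theory Defs
  imports "HOL-Analysis.Analysis"
begin

text \<open>A point of \<open>(\<real>\<^sup>d)\<^sup>n\<close> is \<open>x :: (real ^ 'd) ^ 'n\<close>, with \<open>x $ i\<close> its \<open>i\<close>-th vector;
  here \<open>d = CARD('d)\<close> and \<open>n = CARD('n)\<close>.\<close>

definition Sing :: "((real ^ 'd) ^ 'n) set" where
  "Sing = {x. \<exists>i j. i \<noteq> j \<and> x $ i = x $ j}"

definition antisymmetric :: "((real ^ 'd) ^ 'n \<Rightarrow> real ^ 'm) \<Rightarrow> bool" where
  "antisymmetric \<eta> \<longleftrightarrow>
     (\<forall>\<sigma>. \<sigma> permutes UNIV \<longrightarrow> (\<forall>x. \<eta> (\<chi> i. x $ \<sigma> i) = of_int (sign \<sigma>) *\<^sub>R \<eta> x))"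

definition continuously_differentiable ::
    "('a::real_normed_vector \<Rightarrow> 'b::real_normed_vector) \<Rightarrow> bool" where
  "continuously_differentiable f \<longleftrightarrow>
     (\<exists>f' :: 'a \<Rightarrow> 'a \<Rightarrow>\<^sub>L 'b.
        (\<forall>x. (f has_derivative blinfun_apply (f' x)) (at x)) \<and> continuous_on UNIV f')"

text \<open>The identification \<open>(\<real>\<^sup>d)\<^sup>n = \<real>\<^sup>n\<^sup>d\<close>: scalar coordinates are indexed by pairs
  (vector, component), so the Jacobian matrix below has \<open>n d\<close> scalar columns.\<close>

definition flatten :: "(real ^ 'd) ^ 'n \<Rightarrow> real ^ ('n \<times> 'd)" where
  "flatten x = (\<chi> p. x $ fst p $ snd p)"

definition unflatten :: "real ^ ('n \<times> 'd) \<Rightarrow> (real ^ 'd) ^ 'n" where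
  "unflatten y = (\<chi> i k. y $ (i, k))"

definition Jacobian_matrix ::
    "((real ^ 'd) ^ 'n \<Rightarrow> real ^ 'm) \<Rightarrow> (real ^ 'd) ^ 'n \<Rightarrow> real ^ ('n \<times> 'd) ^ 'm" where
  "Jacobian_matrix \<eta> x = jacobian (\<lambda>y. \<eta> (unflatten y)) (at (flatten x))"

text \<open>Linear dependence is that of the indexed family of columns; the library's
  \<open>dependent (columns A)\<close> concerns the set of columns and would overlook repeated ones.\<close>

definition column_rank_deficient :: "real ^ 'c ^ 'm \<Rightarrow> bool" where
  "column_rank_deficient A \<longleftrightarrow>
     (\<exists>c :: 'c \<Rightarrow> real. (\<exists>j. c j \<noteq> 0) \<and> (\<Sum>j\<in>UNIV. c j *\<^sub>R column j A) = 0)"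

lemma unflatten_flatten [simp]: "unflatten (flatten x) = x"
  by (simp add: flatten_def unflatten_def)

lemma flatten_unflatten [simp]: "flatten (unflatten y) = y"
  by (simp add: flatten_def unflatten_def)

lemma column_rank_deficient_iff_rank:
  fixes A :: "real ^ 'c ^ 'm"
  shows "column_rank_deficient A \<longleftrightarrow> rank A < CARD('c)"
proof -
  have "column_rank_deficient A \<longleftrightarrow> (\<exists>x. x \<noteq> 0 \<and> A *v x = 0)"
  proof
    assume "column_rank_deficient A"
    then obtain c :: "'c \<Rightarrow> real" and j
      where c: "c j \<noteq> 0" "(\<Sum>j\<in>UNIV. c j *\<^sub>R column j A) = 0"
      unfolding column_rank_deficient_def by blast
    have "(\<chi> j. c j) \<noteq> 0" "A *v (\<chi> j. c j) = 0"
      using c by (auto simp: vec_eq_iff matrix_mult_sum scalar_mult_eq_scaleR)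
    then show "\<exists>x. x \<noteq> 0 \<and> A *v x = 0" by blast
  next
    assume "\<exists>x. x \<noteq> 0 \<and> A *v x = 0"
    then show "column_rank_deficient A"
      unfolding column_rank_deficient_def
      by (auto simp: vec_eq_iff matrix_mult_sum scalar_mult_eq_scaleR)
  qed
  also have "\<dots> \<longleftrightarrow> rank A < CARD('c)"
    unfolding matrix_nonfull_linear_equations_eq using rank_bound[of A] by auto
  finally show ?thesis .
qed

end

theory Submission
  imports Defs
begin

text \<open>If the \<open>i\<close>-th and \<open>j\<close>-th vectors of \<open>x\<close> agree, transposing them fixes \<open>x\<close> and changes the
  sign of \<open>\<eta>\<close>, so \<open>\<eta>\<close> vanishes on all of \<open>Sing\<close>. Now move the two coinciding vectors simultaneously
  by the same amount: the resulting line through \<open>x\<close> stays inside \<open>Sing\<close>, hence \<open>\<eta>\<close> is constant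
  along it, and its direction is a nonzero vector in the kernel of the derivative. The coordinates of
  this vector are the coefficients of a linear relation between the columns of the Jacobian matrix.\<close>

lemma antisymmetric_eq_0_on_Sing:
  fixes \<eta> :: "(real ^ 'd) ^ 'n \<Rightarrow> real ^ 'm"
  assumes "antisymmetric \<eta>" and "x \<in> Sing"
  shows "\<eta> x = 0"
proof -
  obtain i j where ij: "i \<noteq> j" "x $ i = x $ j"
    using assms(2) by (auto simp: Sing_def)
  let ?\<tau> = "Transposition.transpose i j"
  have "?\<tau> permutes UNIV"
    by (simp add: permutes_swap_id)
  then have "\<eta> (\<chi> k. x $ ?\<tau> k) = of_int (sign ?\<tau>) *\<^sub>R \<eta> x"
    using assms(1) unfolding antisymmetric_def by blast
  moreover have "(\<chi> k. x $ ?\<tau> k) = x"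
    using ij by (simp add: vec_eq_iff Transposition.transpose_def)
  ultimately have "\<eta> x = - \<eta> x"
    using ij by (simp add: sign_swap_id)
  then show ?thesis
    by (simp add: vec_eq_iff)
qed

lemma bounded_linear_unflatten:
  "bounded_linear (unflatten :: real ^ ('n \<times> 'd) \<Rightarrow> (real ^ 'd) ^ 'n)"
  by (intro linear_conv_bounded_linear[THEN iffD1] linearI) (simp_all add: unflatten_def vec_eq_iff)

lemma Jacobian_matrix_works:
  fixes \<eta> :: "(real ^ 'd) ^ 'n \<Rightarrow> real ^ 'm"
  assumes "(\<eta> has_derivative D) (at x)"
  shows "Jacobian_matrix \<eta> x *v w = D (unflatten w)"
proof -
  have der: "((\<lambda>y. \<eta> (unflatten y)) has_derivative (\<lambda>w. D (unflatten w))) (at (flatten x))"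
    by (rule has_derivative_compose
        [OF bounded_linear_imp_has_derivative[OF bounded_linear_unflatten]])
       (simp add: assms)
  then show ?thesis
    unfolding Jacobian_matrix_def jacobian_def frechet_derivative_at[OF der, symmetric]
    by (simp add: matrix_works has_derivative_linear)
qed

lemma column_rank_deficientI:
  fixes A :: "real ^ 'c ^ 'm"
  assumes "w \<noteq> 0" and "A *v w = 0"
  shows "column_rank_deficient A"
  unfolding column_rank_deficient_def
  using assms
  by (intro exI[of _ "\<lambda>j. w $ j"])
     (auto simp: vec_eq_iff matrix_mult_sum scalar_mult_eq_scaleR)

theorem proposition2p7:
  fixes \<eta> :: "(real ^ 'd) ^ 'n \<Rightarrow> real ^ 'm" and x :: "(real ^ 'd) ^ 'n"
  assumes "antisymmetric \<eta>"
    and "continuously_differentiable \<eta>"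
    and "x \<in> Sing"
  shows "column_rank_deficient (Jacobian_matrix \<eta> x)"
proof -
  obtain D where D: "(\<eta> has_derivative D) (at x)"
    using assms(2) unfolding continuously_differentiable_def by blast
  obtain i j where ij: "i \<noteq> j" "x $ i = x $ j"
    using assms(3) by (auto simp: Sing_def)
  define v :: "(real ^ 'd) ^ 'n" where "v = (\<chi> k. if k = i \<or> k = j then 1 else 0)"
  have "x + t *\<^sub>R v \<in> Sing" for t
    unfolding Sing_def using ij by (intro CollectI exI[of _ i] exI[of _ j]) (simp add: v_def)
  then have zero: "\<eta> (x + t *\<^sub>R v) = 0" for t
    by (rule antisymmetric_eq_0_on_Sing[OF assms(1)])
  have "((\<lambda>t. \<eta> (x + t *\<^sub>R v)) has_derivative (\<lambda>t. D (t *\<^sub>R v))) (at 0)"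
    by (rule has_derivative_compose[where g = \<eta>])
       (auto intro!: derivative_eq_intros simp: D)
  moreover have "((\<lambda>t. \<eta> (x + t *\<^sub>R v)) has_derivative (\<lambda>t. 0)) (at 0)"
    by (simp add: zero)
  ultimately have "(\<lambda>t. D (t *\<^sub>R v)) = (\<lambda>t. 0)"
    by (rule has_derivative_unique)
  then have "D (1 *\<^sub>R v) = 0"
    by (rule fun_cong)
  then have "Jacobian_matrix \<eta> x *v flatten v = 0"
    by (simp add: Jacobian_matrix_works[OF D])
  moreover have "flatten v \<noteq> 0"
    by (auto simp: flatten_def v_def vec_eq_iff)
  ultimately show ?thesis
    by (intro column_rank_deficientI)
qed

end
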